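(* Let $n\ge 1$, let $S \subseteq \mathbb{N}^n$ be a finite set of exponent vectors and let $R \subseteq \mathbb{K}^n$ be a finite set of points. (i) If $|R| < |S|$, then there is a tropical polynomial $p$ over $\mathbb{K}$ with at least one monomial and $\mathrm{Supp}(p)\subseteq S$ that vanishes on $R$. (ii) If $|R| = |S|$, then there is a tropical polynomial $p$ over $\mathbb{K}$ with at least one monomial and $\mathrm{Supp}(p)\subseteq S$ that vanishes on $R$ if and only if $S$ and $R$ are singular. (iii) If $|R| > |S|$, then there is a tropical polynomial $p$ over $\mathbb{K}$ with at least one monomial and $\mathrm{Supp}(p)\subseteq S$ that vanishes on $R$ if and only if for every subset $R'\subset R$ with $|R'|=|S|$ the sets $R'$ and $S$ are singular.
   Context: $\mathbb{K}$ is $\mathbb{R}$ or $\mathbb{Q}$, and $\mathbb{N}$ includes $0$. A tropical polynomial over $\mathbb{K}$ in $\vec{x}=(x_1,\dots,x_n)$ is a finite collection of tropical monomials $m_J(\vec{x}) = c_J + j_1x_1+\dots+j_nx_n$ with pairwise distinct exponent vectors $J=(j_1,\dots,j_n)\in\mathbb{N}^n$ and constants $c_J\in\mathbb{K}$; its value is $p(\vec{x})=\max_J m_J(\vec{x})$. $\mathrm{Supp}(p)$ is the set of exponent vectors $J$ of the monomials occurring in $p$. A point $\vec{a}\in\mathbb{K}^n$ is a root of $p$ if the maximum $\max_J m_J(\vec{a})$ is attained on at least two distinct monomials. $p$ vanishes on a set if all points of the set are roots of $p$. Two finite sets $S,R\subseteq\mathbb{R}^n$ with $|S|=|R|$ are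 called non-singular if there is a bijection $f\colon S\to R$ such that $\sum_{\vec{x}\in S}\langle \vec{x}, f(\vec{x})\rangle$ is strictly greater than the corresponding sum for every other bijection from $S$ to $R$; otherwise $S$ and $R$ are called singular. Here $\langle\cdot,\cdot\rangle$ is the standard inner product. *)

theory Defs
  imports "HOL-Analysis.Analysis"
begin

text \<open>
  A tropical polynomial is a finite partial map from exponent vectors to constants, so the
  exponent vectors of its monomials are pairwise distinct by construction. An exponent vector
  outside the domain stands for an absent monomial (constant minus infinity). The coefficient
  domain is a set \<open>K\<close> of reals, so that \<open>K = UNIV\<close> and \<open>K = \<rat>\<close> are treated uniformly.
\<close>

type_synonym 'n tpoly = "nat ^ 'n \<Rightarrow> real option"

definition trop_poly_over :: "real set \<Rightarrow> 'n::finite tpoly \<Rightarrow> bool" where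
  "trop_poly_over K p \<longleftrightarrow> finite (dom p) \<and> ran p \<subseteq> K"

definition Supp :: "'n::finite tpoly \<Rightarrow> (nat ^ 'n) set" where
  "Supp p = dom p"

definition monomial_value :: "'n::finite tpoly \<Rightarrow> nat ^ 'n \<Rightarrow> real ^ 'n \<Rightarrow> real" where
  "monomial_value p J x = the (p J) + (\<Sum>i\<in>UNIV. real (J $ i) * x $ i)"

text \<open>Only meaningful when \<open>Supp p\<close> is finite and nonempty.\<close>

definition trop_eval :: "'n::finite tpoly \<Rightarrow> real ^ 'n \<Rightarrow> real" where
  "trop_eval p x = Max ((\<lambda>J. monomial_value p J x) ` Supp p)"

definition trop_root :: "'n::finite tpoly \<Rightarrow> real ^ 'n \<Rightarrow> bool" where
  "trop_root p a \<longleftrightarrow>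
     (\<exists>J\<in>Supp p. \<exists>J'\<in>Supp p. J \<noteq> J' \<and>
        monomial_value p J a = trop_eval p a \<and> monomial_value p J' a = trop_eval p a)"

definition vanishes_on :: "'n::finite tpoly \<Rightarrow> (real ^ 'n) set \<Rightarrow> bool" where
  "vanishes_on p R \<longleftrightarrow> (\<forall>a\<in>R. trop_root p a)"

text \<open>The points with all coordinates in \<open>K\<close>, as a subset of real space.\<close>

definition points_over :: "real set \<Rightarrow> (real ^ 'n::finite) set" where
  "points_over K = {x. \<forall>i. x $ i \<in> K}"

definition real_vec :: "nat ^ 'n::finite \<Rightarrow> real ^ 'n" where
  "real_vec J = (\<chi> i. real (J $ i))"

text \<open>
  Both predicates are intended for finite sets of equal cardinality. Bijections are total
  functions here, so two of them count as different only if they differ somewhere on \<open>S\<close>.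
\<close>

definition nonsingular :: "(real ^ 'n::finite) set \<Rightarrow> (real ^ 'n) set \<Rightarrow> bool" where
  "nonsingular S R \<longleftrightarrow>
     (\<exists>f. bij_betw f S R \<and>
        (\<forall>g. bij_betw g S R \<and> (\<exists>x\<in>S. g x \<noteq> f x) \<longrightarrow>
           (\<Sum>x\<in>S. x \<bullet> f x) > (\<Sum>x\<in>S. x \<bullet> g x)))"

definition singular :: "(real ^ 'n::finite) set \<Rightarrow> (real ^ 'n) set \<Rightarrow> bool" where
  "singular S R \<longleftrightarrow> \<not> nonsingular S R"

end

theory Submission
  imports Defs
begin

text \<open>
  Substituting a point into the monomials turns the question into one about the real matrix
  \<open>w r x = r \<bullet> x\<close>, whose rows are the points and whose columns are the exponent vectors. A
  polynomial is a choice of real offsets on a nonempty set of columns, and it vanishes on the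
  points when, after adding the offsets, every row attains its maximum at least twice; the columns
  are then tropically dependent. All three parts follow from one statement: the columns are
  dependent if and only if no square submatrix that uses all columns has a unique optimal
  assignment of its rows to the columns. With fewer rows than columns there is no such submatrix,
  with equally many there is only one.

  A dependence rules out a unique optimum
  (\<open>tropically_dependent_imp_not_uniquely_assignable\<close>): each column \<open>x\<close> of the dependence is
  matched to a row that has another column \<open>k x\<close> at least as large as \<open>x\<close>. The map \<open>k\<close> has no
  fixed point but permutes some nonempty set of columns, and moving the matching along this
  permutation yields a different assignment that is no worse.

  For the converse (\<open>dependent_or_every_column_dominates\<close>), start with zero offsets and repeatedly
  lower every column that is the strict maximum of some row until it ties with the other columns,
  but by at most one per round. The offsets decrease. If some of them stay bounded, their limits
  form a dependence of the corresponding columns. If all of them are unbounded, then averaging the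
  finitely many iterates of a long enough run, in the min-plus sense, gives offsets which one
  further round lowers in every coordinate. For such offsets every column is the strict maximum of
  some row. These rows are distinct, and assigning each of them to its column is the unique
  optimum, because the offsets contribute the same total to every assignment.

  The limits need not lie in the coefficient domain. When all entries are rational,
  \<open>tropically_dependent_rational\<close> perturbs the offsets into the rationals: columns can only tie if
  their offsets have a rational difference, so it suffices to move each class modulo the rationals
  as a block by a small amount.
\<close>

section \<open>Dependence and unique assignments\<close>

text \<open>
  The condition on the rows says that no column of \<open>B\<close> is the only maximum of a row, after adding
  the offsets \<open>c\<close>. In this form it is a family of inequalities, which passes to limits without any
  choice of the two maximal columns.
\<close>

definition tropically_dependent ::
    "real set \<Rightarrow> ('r \<Rightarrow> 's \<Rightarrow> real) \<Rightarrow> 'r set \<Rightarrow> 's set \<Rightarrow> bool" where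
  "tropically_dependent K w R S \<longleftrightarrow>
     (\<exists>B c. B \<subseteq> S \<and> B \<noteq> {} \<and> c ` B \<subseteq> K \<and>
        (\<forall>r\<in>R. \<forall>x\<in>B. \<exists>y\<in>B. y \<noteq> x \<and> c x + w r x \<le> c y + w r y))"

text \<open>
  Non-singularity with the inner product replaced by an arbitrary weight.
\<close>

definition uniquely_assignable :: "('r \<Rightarrow> 's \<Rightarrow> real) \<Rightarrow> 'r set \<Rightarrow> 's set \<Rightarrow> bool" where
  "uniquely_assignable w R S \<longleftrightarrow>
     (\<exists>f. bij_betw f R S \<and>
        (\<forall>g. bij_betw g R S \<and> (\<exists>r\<in>R. g r \<noteq> f r) \<longrightarrow>
           (\<Sum>r\<in>R. w r (f r)) > (\<Sum>r\<in>R. w r (g r))))"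

text \<open>
  Inverting bijections preserves their weight. The symmetry matters because the square case and the
  general case of the theorem name the two sets in opposite orders.
\<close>

lemma uniquely_assignable_swap:
  assumes "uniquely_assignable w R S"
  shows "uniquely_assignable (\<lambda>x r. w r x) S R"
proof -
  obtain f where f: "bij_betw f R S"
    and best: "\<forall>g. bij_betw g R S \<and> (\<exists>r\<in>R. g r \<noteq> f r) \<longrightarrow>
      (\<Sum>r\<in>R. w r (g r)) < (\<Sum>r\<in>R. w r (f r))"
    using assms unfolding uniquely_assignable_def by (elim exE conjE)
  have reindex: "(\<Sum>x\<in>S. w (the_inv_into R g x) x) = (\<Sum>r\<in>R. w r (g r))"
    if g: "bij_betw g R S" for g
    using sum.reindex_bij_betw[OF g, of "\<lambda>x. w (the_inv_into R g x) x"] g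
    by (simp add: bij_betw_def the_inv_into_f_f)
  let ?f = "the_inv_into R f"
  have "(\<Sum>x\<in>S. w (h x) x) < (\<Sum>x\<in>S. w (?f x) x)"
    if h: "bij_betw h S R" and ne: "\<exists>x\<in>S. h x \<noteq> ?f x" for h
  proof -
    let ?g = "the_inv_into S h"
    have g: "bij_betw ?g R S" using h by (rule bij_betw_the_inv_into)
    have h_eq: "the_inv_into R ?g x = h x" if "x \<in> S" for x
      using that h by (metis bij_betw_def bij_betwE g the_inv_into_f_f the_inv_into_f_eq)
    have "\<exists>r\<in>R. ?g r \<noteq> f r"
    proof -
      obtain x where x: "x \<in> S" "h x \<noteq> ?f x" using ne by blast
      have "h x \<in> R" "?g (h x) = x" using x h by (auto simp: bij_betw_def the_inv_into_f_f)
      moreover have "f (h x) \<noteq> x"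
        using x f \<open>h x \<in> R\<close> by (metis bij_betw_def the_inv_into_f_f)
      ultimately show ?thesis by metis
    qed
    from best[rule_format, OF conjI[OF g this]] have "(\<Sum>x\<in>S. w (the_inv_into R ?g x) x) < (\<Sum>x\<in>S. w (?f x) x)"
      using reindex[OF g] reindex[OF f] by simp
    then show ?thesis using h_eq by simp
  qed
  then show ?thesis
    unfolding uniquely_assignable_def using bij_betw_the_inv_into[OF f] by blast
qed

section \<open>Lowering the dominating columns\<close>

text \<open>
  One round of the descent. In the row \<open>r\<close> the column \<open>x\<close> may stay at most at the level at which
  it ties with the largest of the other columns. The summand for \<open>y = x\<close> caps the decrease at one,
  so that the maximum ranges over a nonempty set even if \<open>x\<close> is the only column; inserting \<open>c x\<close>
  makes the round decreasing, and meaningful also if there are no rows.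
\<close>

definition lower :: "('r \<Rightarrow> 's \<Rightarrow> real) \<Rightarrow> 'r set \<Rightarrow> 's set \<Rightarrow> ('s \<Rightarrow> real) \<Rightarrow> 's \<Rightarrow> real" where
  "lower w R S c x =
     Min (insert (c x)
       ((\<lambda>r. Max ((\<lambda>y. c y + w r y - w r x - (if y = x then 1 else 0)) ` S)) ` R))"

lemma le_lower_iff:
  assumes "finite R" "finite S" "S \<noteq> {}"
  shows "t \<le> lower w R S c x \<longleftrightarrow>
    t \<le> c x \<and> (\<forall>r\<in>R. \<exists>y\<in>S. t \<le> c y + w r y - w r x - (if y = x then 1 else 0))"
  unfolding lower_def using assms by (subst Min_ge_iff) (auto simp: Max_ge_iff)

text \<open>
  Monotonicity and compatibility with adding a constant to all offsets, in a single inequality.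
\<close>

lemma lower_mono_shift:
  assumes fin: "finite R" "finite S" and x: "x \<in> S"
    and le: "\<And>y. y \<in> S \<Longrightarrow> c y \<le> c' y + t"
  shows "lower w R S c x \<le> lower w R S c' x + t"
proof -
  have ne: "S \<noteq> {}" using x by auto
  note iff = le_lower_iff[OF fin ne]
  have own: "lower w R S c x \<le> c x"
    and row: "\<forall>r\<in>R. \<exists>y\<in>S. lower w R S c x \<le> c y + w r y - w r x - (if y = x then 1 else 0)"
    using iff[of "lower w R S c x" w c x] by auto
  have "lower w R S c x - t \<le> lower w R S c' x"
    unfolding iff
  proof (intro conjI ballI)
    show "lower w R S c x - t \<le> c' x" using own le[OF x] by linarith
    fix r assume "r \<in> R"
    then obtain y where "y \<in> S" "lower w R S c x \<le> c y + w r y - w r x - (if y = x then 1 else 0)"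
      using row by blast
    then show "\<exists>y\<in>S. lower w R S c x - t \<le> c' y + w r y - w r x - (if y = x then 1 else 0)"
      using le[of y] by (intro bexI[of _ y]) auto
  qed
  then show ?thesis by linarith
qed

lemma lower_lt_imp_dominating_row:
  assumes fin: "finite R" "finite S" and x: "x \<in> S" and lt: "lower w R S c x < c x"
  shows "\<exists>r\<in>R. \<forall>y\<in>S. y \<noteq> x \<longrightarrow> c y + w r y < c x + w r x"
proof (rule ccontr)
  assume "\<not> ?thesis"
  then have no: "\<forall>r\<in>R. \<exists>y\<in>S. y \<noteq> x \<and> c x + w r x \<le> c y + w r y"
    by (meson not_less)
  have ne: "S \<noteq> {}" using x by auto
  have "c x \<le> lower w R S c x"
    unfolding le_lower_iff[OF fin ne]
  proof (intro conjI ballI)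
    fix r assume "r \<in> R"
    then obtain y where "y \<in> S" "y \<noteq> x" "c x + w r x \<le> c y + w r y"
      using no by blast
    then show "\<exists>y\<in>S. c x \<le> c y + w r y - w r x - (if y = x then 1 else 0)"
      by (intro bexI[of _ y]) auto
  qed simp
  with lt show False by simp
qed

text \<open>
  Finitely many eventual properties hold simultaneously from some index on. This serves as the
  pigeonhole principle below: if each of finitely many columns fails as a witness at some stage,
  then from a common stage on there is no witness left.
\<close>

lemma finite_uniform_index:
  fixes P :: "'a \<Rightarrow> nat \<Rightarrow> bool"
  assumes "finite A" "\<And>x. x \<in> A \<Longrightarrow> \<exists>k. P x k" "\<And>x j k. P x j \<Longrightarrow> j \<le> k \<Longrightarrow> P x k"
  shows "\<exists>k. \<forall>x\<in>A. P x k"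
proof -
  have "\<forall>\<^sub>F k in sequentially. \<forall>x\<in>A. P x k"
    using assms by (intro eventually_ball_finite) (simp_all add: eventually_sequentially, blast)
  then show ?thesis by (auto simp: eventually_sequentially)
qed

text \<open>
  The alternative behind the theorem, obtained by iterating \<open>lower\<close> from zero. The set \<open>B\<close> collects
  the columns whose offsets stay bounded below. If it is nonempty, a bounded column cannot be held
  up by an unbounded one, nor by its own cap, so the limits satisfy the inequalities of a
  dependence within \<open>B\<close>.
\<close>

lemma dependent_or_every_column_dominates:
  fixes w :: "'r \<Rightarrow> 's \<Rightarrow> real"
  assumes fin: "finite R" "finite S"
  shows "tropically_dependent UNIV w R S \<or>
    (\<exists>c. \<forall>x\<in>S. \<exists>r\<in>R. \<forall>y\<in>S. y \<noteq> x \<longrightarrow> c y + w r y < c x + w r x)"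
proof (cases "S = {}")
  case False
  define d where "d k = (lower w R S ^^ k) (\<lambda>_. 0)" for k
  have d_Suc: "d (Suc k) = lower w R S (d k)" for k by (simp add: d_def)
  have d_0: "d 0 x = 0" for x by (simp add: d_def)
  note iff = le_lower_iff[OF fin False]
  have d_step: "d (Suc k) x \<le> d k x" for k x
    using iff[of "d (Suc k) x" w "d k" x] by (simp add: d_Suc)
  have d_anti: "d k x \<le> d j x" if "j \<le> k" for j k x
    using lift_Suc_antimono_le[of "\<lambda>k. d k x"] d_step that by blast
  define B where "B = {x\<in>S. \<exists>m. \<forall>k. m \<le> d k x}"
  show ?thesis
  proof (cases "B = {}")
    case nonempty: False
    define L where "L x = (INF k. d k x)" for x
    have L_le: "L x \<le> d k x" if x: "x \<in> B" for x k
    proof -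
      obtain m where "\<forall>k. m \<le> d k x" using x by (auto simp: B_def)
      then have "bdd_below (range (\<lambda>k. d k x))" by (intro bdd_belowI2[of _ m]) auto
      then show ?thesis unfolding L_def by (rule cINF_lower) simp
    qed
    have "\<exists>y\<in>B. y \<noteq> x \<and> L x + w r x \<le> L y + w r y" if r: "r \<in> R" and x: "x \<in> B" for r x
    proof -
      let ?\<iota> = "\<lambda>y. if y = x then 1 else 0 :: real"
      have each: "\<exists>y\<in>S. L x \<le> d k y + w r y - w r x - ?\<iota> y" for k
        using iff[of "L x" w "d k" x] L_le[OF x, of "Suc k"] r by (auto simp: d_Suc)
      (* The column that holds up x may vary with the stage k. As d decreases in k, one that fails
         fails forever, so a single column works for all stages. *)
      have "\<exists>y\<in>S. \<forall>k. L x \<le> d k y + w r y - w r x - ?\<iota> y"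
      proof (rule ccontr)
        assume none: "\<not> ?thesis"
        have "\<exists>k. \<forall>y\<in>S. d k y + w r y - w r x - ?\<iota> y < L x"
        proof (rule finite_uniform_index[OF fin(2)])
          fix y assume "y \<in> S"
          then show "\<exists>k. d k y + w r y - w r x - ?\<iota> y < L x"
            using none by (meson not_le)
        next
          fix y j k assume "d j y + w r y - w r x - ?\<iota> y < L x" "j \<le> k"
          then show "d k y + w r y - w r x - ?\<iota> y < L x"
            using d_anti[of j k y] by linarith
        qed
        then show False using each by (meson not_less)
      qed
      then obtain y where y: "y \<in> S" "\<And>k. L x \<le> d k y + w r y - w r x - ?\<iota> y"
        by blast
      have low: "L x - w r y + w r x + ?\<iota> y \<le> d k y" for k using y(2)[of k] by linarith
      then have "y \<in> B" using y(1) by (auto simp: B_def)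
      moreover have Ly: "L x - w r y + w r x + ?\<iota> y \<le> L y"
        unfolding L_def[of y] using low by (intro cINF_greatest) auto
      (* For y = x the cap would give L x + 1 \<le> L x. *)
      moreover have "y \<noteq> x" using Ly by auto
      ultimately show ?thesis by (intro bexI[of _ y]) auto
    qed
    then have "tropically_dependent UNIV w R S"
      unfolding tropically_dependent_def
      by (intro exI[of _ B] exI[of _ L]) (use nonempty in \<open>auto simp: B_def\<close>)
    then show ?thesis ..
  next
    case True
    have "\<exists>k. \<forall>x\<in>S. d k x < 0"
    proof (intro finite_uniform_index fin)
      fix x assume "x \<in> S"
      then show "\<exists>k. d k x < 0" using True by (fastforce simp: B_def not_le)
    qed (meson d_anti le_less_trans)
    then obtain k where k: "\<And>x. x \<in> S \<Longrightarrow> d k x < 0" by blast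
    then have k_pos: "k > 0" using False by (metis d_0 ex_in_conv gr0I less_irrefl)
    (* After k rounds every offset has dropped by at least k * \<epsilon>, that is, by \<epsilon> per round on
       average. Tilting the iterates by this rate and taking their minimum turns the average drop
       into a drop in a single round: a round maps the j-th tilted iterate to the next one lowered
       by \<epsilon>, and the last tilted iterate already lies below the first one. *)
    define \<epsilon> where "\<epsilon> = - Max (d k ` S) / k"
    have \<epsilon>: "\<epsilon> > 0" using k k_pos fin False by (auto simp: \<epsilon>_def divide_neg_pos)
    have dk: "d k x + k * \<epsilon> \<le> 0" if "x \<in> S" for x
      using that fin k_pos by (simp add: \<epsilon>_def)
    define c where "c x = Min ((\<lambda>j. d j x + j * \<epsilon>) ` {..k})" for x
    have c_le: "c x \<le> d j x + j * \<epsilon>" if "j \<le> k" for j x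
      using that by (auto simp: c_def)
    have "lower w R S c x < c x" if x: "x \<in> S" for x
    proof -
      have step: "lower w R S c x \<le> d (Suc j) x + j * \<epsilon>" if "j \<le> k" for j
        using lower_mono_shift[OF fin x, of c "d j" "j * \<epsilon>"] c_le that by (auto simp: d_Suc)
      have "c x \<in> (\<lambda>j. d j x + j * \<epsilon>) ` {..k}"
        unfolding c_def by (rule Min_in) auto
      then obtain j where j: "j \<le> k" "c x = d j x + j * \<epsilon>" by auto
      show ?thesis
      proof (cases j)
        (* Here c x = d 0 x, which bounds the last tilted iterate, so that index takes over. *)
        case 0
        obtain i where "k = Suc i" using k_pos by (cases k) auto
        then show ?thesis
          using step[of i] dk[OF x] \<epsilon> j 0 by (auto simp: d_0 algebra_simps)
      next
        case (Suc i)
        then show ?thesis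
          using step[of i] \<epsilon> j by (auto simp: algebra_simps)
      qed
    qed
    then show ?thesis using lower_lt_imp_dominating_row[OF fin] by blast
  qed
qed auto

section \<open>Dominating columns and unique optima\<close>

text \<open>
  A row has at most one strict maximum, so distinct columns dominate distinct rows. Adding the
  offsets changes the value of every assignment by the same constant, and afterwards the assignment
  of dominated rows to their columns is strictly best row by row.
\<close>

lemma column_domination_imp_uniquely_assignable:
  fixes w :: "'r \<Rightarrow> 's \<Rightarrow> real"
  assumes fin: "finite S"
    and dom: "\<forall>x\<in>S. \<exists>r\<in>R. \<forall>y\<in>S. y \<noteq> x \<longrightarrow> c y + w r y < c x + w r x"
  shows "\<exists>R'\<subseteq>R. card R' = card S \<and> uniquely_assignable w R' S"
proof -
  obtain row where row: "\<And>x. x \<in> S \<Longrightarrow> row x \<in> R"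
    and strict: "\<And>x y. x \<in> S \<Longrightarrow> y \<in> S \<Longrightarrow> y \<noteq> x \<Longrightarrow> c y + w (row x) y < c x + w (row x) x"
    using dom by metis
  have inj: "inj_on row S"
    using strict by (intro inj_onI) (metis less_asym)
  define R' where "R' = row ` S"
  have finR: "finite R'" using fin by (simp add: R'_def)
  define f where "f = the_inv_into S row"
  have f: "bij_betw f R' S"
    unfolding f_def R'_def using inj by (intro bij_betw_the_inv_into inj_on_imp_bij_betw)
  have strict': "c y + w r y < c (f r) + w r (f r)" if "r \<in> R'" "y \<in> S" "y \<noteq> f r" for r y
    using that strict inj by (auto simp: R'_def f_def the_inv_into_f_f)
  have "(\<Sum>r\<in>R'. w r (g r)) < (\<Sum>r\<in>R'. w r (f r))"
    if g: "bij_betw g R' S" and ne: "\<exists>r\<in>R'. g r \<noteq> f r" for g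
  proof -
    have "(\<Sum>r\<in>R'. c (g r) + w r (g r)) < (\<Sum>r\<in>R'. c (f r) + w r (f r))"
    proof (rule sum_strict_mono_ex1[OF finR])
      show "\<forall>r\<in>R'. c (g r) + w r (g r) \<le> c (f r) + w r (f r)"
        using strict' bij_betwE[OF g] by (metis less_imp_le order_refl)
      show "\<exists>r\<in>R'. c (g r) + w r (g r) < c (f r) + w r (f r)"
        using strict' bij_betwE[OF g] ne by metis
    qed
    moreover have "(\<Sum>r\<in>R'. c (g r)) = (\<Sum>r\<in>R'. c (f r))"
      using sum.reindex_bij_betw[OF f, of c] sum.reindex_bij_betw[OF g, of c] by simp
    ultimately show ?thesis by (simp add: sum.distrib)
  qed
  then have "uniquely_assignable w R' S"
    unfolding uniquely_assignable_def using f by blast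
  moreover have "R' \<subseteq> R" "card R' = card S"
    using row inj by (auto simp: R'_def card_image)
  ultimately show ?thesis by blast
qed

section \<open>Dependence excludes unique optima\<close>

text \<open>
  A minimal nonempty invariant subset equals its own image, hence is permuted. It replaces the
  explicit construction of a cycle.
\<close>

lemma ex_bij_betw_invariant_subset:
  assumes "finite T" "T \<noteq> {}" "k ` T \<subseteq> T"
  shows "\<exists>X\<subseteq>T. X \<noteq> {} \<and> bij_betw k X X"
proof -
  let ?C = "{X. X \<subseteq> T \<and> X \<noteq> {} \<and> k ` X \<subseteq> X}"
  have "finite ?C" using assms(1) by simp
  moreover have "?C \<noteq> {}" using assms by blast
  ultimately obtain X where X: "X \<in> ?C" and min: "\<forall>Y\<in>?C. Y \<subseteq> X \<longrightarrow> X = Y"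
    by (rule bexE[OF finite_has_minimal[of ?C]])
  have "k ` X \<in> ?C" "k ` X \<subseteq> X" using X by auto
  then have "k ` X = X" using bspec[OF min, of "k ` X"] by simp
  moreover have "finite X" using X assms(1) finite_subset by auto
  ultimately have "bij_betw k X X"
    by (simp add: bij_betw_def eq_card_imp_inj_on)
  then show ?thesis using X by blast
qed

text \<open>
  Rerouting an optimal assignment along the permuted set of columns loses nothing, since every
  rerouted row receives a column that is at least as large after adding the offsets, and the total
  of the offsets is the same for all assignments. The dependence may leave out columns of \<open>S\<close>; the
  rows matched to these keep their columns.
\<close>

lemma tropically_dependent_imp_not_uniquely_assignable:
  assumes fin: "finite S" and R': "R' \<subseteq> R" and dep: "tropically_dependent K w R S"
  shows "\<not> uniquely_assignable w R' S"
proof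
  assume "uniquely_assignable w R' S"
  then obtain f where f: "bij_betw f R' S"
    and best: "\<forall>g. bij_betw g R' S \<and> (\<exists>r\<in>R'. g r \<noteq> f r) \<longrightarrow>
      (\<Sum>r\<in>R'. w r (g r)) < (\<Sum>r\<in>R'. w r (f r))"
    unfolding uniquely_assignable_def by (elim exE conjE)
  obtain B c where B: "B \<subseteq> S" "B \<noteq> {}" and "c ` B \<subseteq> K"
    and tie: "\<forall>r\<in>R. \<forall>x\<in>B. \<exists>y\<in>B. y \<noteq> x \<and> c x + w r x \<le> c y + w r y"
    using dep unfolding tropically_dependent_def by (elim exE conjE)
  define row where "row = the_inv_into R' f"
  have row: "row x \<in> R'" "f (row x) = x" if "x \<in> S" for x
    using that bij_betwE[OF bij_betw_the_inv_into[OF f]] f_the_inv_into_f_bij_betw[OF f]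
    unfolding row_def by auto
  have row_f: "row (f r) = r" if "r \<in> R'" for r
    using that f unfolding row_def by (auto simp: bij_betw_def the_inv_into_f_f)
  have "\<forall>x\<in>B. \<exists>y. y \<in> B \<and> y \<noteq> x \<and> c x + w (row x) x \<le> c y + w (row x) y"
  proof
    fix x assume x: "x \<in> B"
    then have "row x \<in> R" using row(1) R' B(1) by blast
    then show "\<exists>y. y \<in> B \<and> y \<noteq> x \<and> c x + w (row x) x \<le> c y + w (row x) y"
      using tie x by blast
  qed
  from bchoice[OF this] obtain k where k: "\<And>x. x \<in> B \<Longrightarrow> k x \<in> B" "\<And>x. x \<in> B \<Longrightarrow> k x \<noteq> x"
    "\<And>x. x \<in> B \<Longrightarrow> c x + w (row x) x \<le> c (k x) + w (row x) (k x)"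
    by auto
  have "\<exists>X\<subseteq>B. X \<noteq> {} \<and> bij_betw k X X"
    using k B fin by (intro ex_bij_betw_invariant_subset) (auto intro: finite_subset)
  then obtain X where X: "X \<subseteq> B" "X \<noteq> {}" "bij_betw k X X" by blast
  define \<sigma> where "\<sigma> x = (if x \<in> X then k x else x)" for x
  have \<sigma>: "bij_betw \<sigma> S S"
  proof -
    have "bij_betw \<sigma> X X" using X(3) by (subst bij_betw_cong[of _ _ k]) (auto simp: \<sigma>_def)
    moreover have "bij_betw \<sigma> (S - X) (S - X)"
      by (subst bij_betw_cong[of _ _ id]) (auto simp: \<sigma>_def)
    ultimately have "bij_betw \<sigma> (X \<union> (S - X)) (X \<union> (S - X))"
      by (rule bij_betw_combine) auto
    moreover have "X \<union> (S - X) = S" using X B by auto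
    ultimately show ?thesis by simp
  qed
  have g: "bij_betw (\<lambda>r. \<sigma> (f r)) R' S"
    using bij_betw_trans[OF f \<sigma>] by (simp add: comp_def)
  have "\<exists>r\<in>R'. \<sigma> (f r) \<noteq> f r"
  proof -
    obtain x where "x \<in> X" using X by blast
    moreover from this have "x \<in> S" "x \<in> B" using X B by auto
    ultimately have "\<sigma> (f (row x)) \<noteq> f (row x)" using row(2) k(2) by (simp add: \<sigma>_def)
    then show ?thesis using row(1) \<open>x \<in> S\<close> by blast
  qed
  then have less: "(\<Sum>r\<in>R'. w r (\<sigma> (f r))) < (\<Sum>r\<in>R'. w r (f r))" using best g by blast
  have "(\<Sum>r\<in>R'. c (f r) + w r (f r)) \<le> (\<Sum>r\<in>R'. c (\<sigma> (f r)) + w r (\<sigma> (f r)))"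
  proof (rule sum_mono)
    fix r assume "r \<in> R'"
    then show "c (f r) + w r (f r) \<le> c (\<sigma> (f r)) + w r (\<sigma> (f r))"
      using k(3)[of "f r"] X(1) by (auto simp: \<sigma>_def row_f)
  qed
  moreover have "(\<Sum>r\<in>R'. c (\<sigma> (f r))) = (\<Sum>r\<in>R'. c (f r))"
    using sum.reindex_bij_betw[OF f, of c] sum.reindex_bij_betw[OF g, of c] by simp
  ultimately show False using less by (simp add: sum.distrib)
qed

section \<open>Rational coefficients\<close>

text \<open>
  For rational entries, equality of two columns in a row forces a rational difference of their
  offsets. Every class of offsets modulo the rationals is shifted as a block by less than \<open>\<delta>\<close>,
  so ties persist, and strict inequalities persist because \<open>\<delta>\<close> is at most the smallest of the
  finitely many positive gaps.
\<close>

lemma tropically_dependent_rational: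
  fixes w :: "'r \<Rightarrow> 's \<Rightarrow> real"
  assumes fin: "finite R" "finite S"
    and rat: "\<And>r x. r \<in> R \<Longrightarrow> x \<in> S \<Longrightarrow> w r x \<in> \<rat>"
    and dep: "tropically_dependent UNIV w R S"
  shows "tropically_dependent \<rat> w R S"
proof -
  obtain B c where B: "B \<subseteq> S" "B \<noteq> {}" and "c ` B \<subseteq> UNIV"
    and tie: "\<forall>r\<in>R. \<forall>x\<in>B. \<exists>y\<in>B. y \<noteq> x \<and> c x + w r x \<le> c y + w r y"
    using dep unfolding tropically_dependent_def by (elim exE conjE)
  (* A representative of the class of t modulo the rationals, the same for the whole class. *)
  define rep :: "real \<Rightarrow> real" where "rep t = (SOME u. t - u \<in> \<rat>)" for t
  have rep_rat: "t - rep t \<in> \<rat>" for t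
    unfolding rep_def by (rule someI[of _ t]) simp
  have rep_eq: "rep t = rep u" if "t - u \<in> \<rat>" for t u
  proof -
    have "t - v \<in> \<rat> \<longleftrightarrow> u - v \<in> \<rat>" for v
      using Rats_diff[OF _ that, of "t - v"] Rats_add[OF _ that, of "u - v"] by auto
    then show ?thesis by (simp add: rep_def)
  qed
  let ?gap = "\<lambda>(r, x, y). (c y + w r y) - (c x + w r x)"
  let ?P = "{p \<in> R \<times> B \<times> B. ?gap p > 0}"
  have "finite B" using fin(2) B(1) by (rule finite_subset[rotated])
  then have "finite ?P" using fin(1) by simp
  define \<delta> where "\<delta> = Min (insert 1 (?gap ` ?P))"
  have \<delta>: "\<delta> > 0" "\<forall>p\<in>?P. \<delta> \<le> ?gap p"
    using \<open>finite ?P\<close> unfolding \<delta>_def by (subst Min_gr_iff, auto)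
  have "\<exists>q\<in>\<rat>. t < q \<and> q < t + \<delta>" for t using Rats_dense_in_real[of t "t + \<delta>"] \<delta>(1) by auto
  then obtain q where q: "\<And>t. q t \<in> \<rat>" "\<And>t. t < q t" "\<And>t. q t < t + \<delta>" by metis
  define c' where "c' x = (c x - rep (c x)) + q (rep (c x))" for x
  have c'_bounds: "c x < c' x" "c' x < c x + \<delta>" for x
    using q(2,3)[of "rep (c x)"] by (auto simp: c'_def)
  have "\<exists>y\<in>B. y \<noteq> x \<and> c' x + w r x \<le> c' y + w r y" if r: "r \<in> R" and x: "x \<in> B" for r x
  proof -
    obtain y where y: "y \<in> B" "y \<noteq> x" and le: "c x + w r x \<le> c y + w r y"
      using tie r x by blast
    have "c' x + w r x \<le> c' y + w r y"
    proof (cases "c x + w r x = c y + w r y")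
      case True
      then have "c x - c y = w r y - w r x" by linarith
      then have "rep (c x) = rep (c y)"
        using rat r x y B by (intro rep_eq) (auto intro!: Rats_diff)
      then show ?thesis using le by (simp add: c'_def)
    next
      case False
      then have "\<delta> \<le> (c y + w r y) - (c x + w r x)"
        using le r x y \<delta>(2)[rule_format, of "(r, x, y)"] by auto
      then show ?thesis using c'_bounds(2)[of x] c'_bounds(1)[of y] by linarith
    qed
    then show ?thesis using y by blast
  qed
  moreover have "c' ` B \<subseteq> \<rat>" using rep_rat q(1) by (auto simp: c'_def)
  ultimately show ?thesis unfolding tropically_dependent_def using B by blast
qed

section \<open>Tropical polynomials as dependences\<close>

lemma nonsingular_iff_uniquely_assignable:
  "nonsingular R S \<longleftrightarrow> uniquely_assignable (\<bullet>) R S"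
  unfolding nonsingular_def uniquely_assignable_def ..

lemma nonsingular_commute: "nonsingular R S \<longleftrightarrow> nonsingular S R"
  unfolding nonsingular_iff_uniquely_assignable
  using uniquely_assignable_swap[of "(\<bullet>)" R S] uniquely_assignable_swap[of "(\<bullet>)" S R]
  by (auto simp: inner_commute)

lemma inj_real_vec: "inj real_vec"
  by (rule injI) (simp add: real_vec_def vec_eq_iff)

lemma monomial_value_eq: "monomial_value p J x = the (p J) + x \<bullet> real_vec J"
  by (simp add: monomial_value_def real_vec_def inner_vec_def mult.commute)

text \<open>
  A root is a point at which no monomial is the only maximum. For one direction it suffices to
  apply the right-hand side to a monomial that attains the maximum.
\<close>

lemma trop_root_iff:
  assumes "finite (Supp p)" "Supp p \<noteq> {}"
  shows "trop_root p a \<longleftrightarrow> (\<forall>J\<in>Supp p. \<exists>J'\<in>Supp p. J' \<noteq> J \<and>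
    monomial_value p J a \<le> monomial_value p J' a)"
proof -
  let ?v = "\<lambda>J. monomial_value p J a"
  have ge: "?v J \<le> trop_eval p a" if "J \<in> Supp p" for J
    unfolding trop_eval_def using assms that by simp
  have "trop_eval p a \<in> ?v ` Supp p"
    unfolding trop_eval_def using assms by (intro Max_in) auto
  then obtain M where M: "M \<in> Supp p" "?v M = trop_eval p a" by auto
  show ?thesis
  proof
    assume "trop_root p a"
    then show "\<forall>J\<in>Supp p. \<exists>J'\<in>Supp p. J' \<noteq> J \<and> ?v J \<le> ?v J'"
      using ge unfolding trop_root_def by metis
  next
    assume "\<forall>J\<in>Supp p. \<exists>J'\<in>Supp p. J' \<noteq> J \<and> ?v J \<le> ?v J'"
    then obtain J' where "J' \<in> Supp p" "J' \<noteq> M" "?v M \<le> ?v J'" using M by blast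
    then show "trop_root p a"
      unfolding trop_root_def using M ge by (metis order_antisym)
  qed
qed

lemma vanishing_polynomial_iff_tropically_dependent:
  fixes S :: "(nat ^ 'n::finite) set"
  assumes fin: "finite S"
  shows "(\<exists>p. trop_poly_over K p \<and> Supp p \<noteq> {} \<and> Supp p \<subseteq> S \<and> vanishes_on p R) \<longleftrightarrow>
    tropically_dependent K (\<bullet>) R (real_vec ` S)"
proof
  assume "\<exists>p. trop_poly_over K p \<and> Supp p \<noteq> {} \<and> Supp p \<subseteq> S \<and> vanishes_on p R"
  then obtain p where p: "trop_poly_over K p" "Supp p \<noteq> {}" "Supp p \<subseteq> S" "vanishes_on p R"
    by blast
  have "finite (Supp p)" using p(3) fin finite_subset by blast
  note root = trop_root_iff[OF this p(2)]
  define c where "c x = the (p (the_inv real_vec x))" for x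
  have c: "c (real_vec J) = the (p J)" for J
    by (simp add: c_def the_inv_f_f[OF inj_real_vec])
  show "tropically_dependent K (\<bullet>) R (real_vec ` S)"
    unfolding tropically_dependent_def
  proof (intro exI[of _ "real_vec ` Supp p"] exI[of _ c] conjI ballI)
    show "c ` real_vec ` Supp p \<subseteq> K"
      using p(1) by (auto simp: c trop_poly_over_def Supp_def ran_def)
    fix r x assume "r \<in> R" "x \<in> real_vec ` Supp p"
    then obtain J where J: "J \<in> Supp p" "x = real_vec J" by blast
    then obtain J' where "J' \<in> Supp p" "J' \<noteq> J" "monomial_value p J r \<le> monomial_value p J' r"
      using p(4) \<open>r \<in> R\<close> root unfolding vanishes_on_def by blast
    then show "\<exists>y\<in>real_vec ` Supp p. y \<noteq> x \<and> c x + r \<bullet> x \<le> c y + r \<bullet> y"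
      using J by (auto simp: c monomial_value_eq inj_eq[OF inj_real_vec])
  qed (use p in auto)
next
  assume "tropically_dependent K (\<bullet>) R (real_vec ` S)"
  then obtain B c where B: "B \<subseteq> real_vec ` S" "B \<noteq> {}" "c ` B \<subseteq> K"
    and tie: "\<forall>r\<in>R. \<forall>x\<in>B. \<exists>y\<in>B. y \<noteq> x \<and> c x + r \<bullet> x \<le> c y + r \<bullet> y"
    unfolding tropically_dependent_def by (elim exE conjE)
  define p where "p J = (if real_vec J \<in> B then Some (c (real_vec J)) else None)" for J :: "nat ^ 'n"
  have supp: "Supp p = {J. real_vec J \<in> B}"
    by (auto simp: Supp_def p_def dom_def)
  have sub: "Supp p \<subseteq> S"
    using B(1) by (auto simp: supp inj_eq[OF inj_real_vec] dest!: subsetD)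
  then have finp: "finite (Supp p)" using fin finite_subset by blast
  have nep: "Supp p \<noteq> {}" using B by (auto simp: supp)
  have "trop_poly_over K p"
    using finp B(3) by (auto simp: trop_poly_over_def Supp_def ran_def p_def split: if_splits)
  moreover have "vanishes_on p R"
    unfolding vanishes_on_def trop_root_iff[OF finp nep]
  proof (intro ballI)
    fix r J assume "r \<in> R" "J \<in> Supp p"
    then obtain y where y: "y \<in> B" "y \<noteq> real_vec J" "c (real_vec J) + r \<bullet> real_vec J \<le> c y + r \<bullet> y"
      using tie by (auto simp: supp)
    then obtain J' where "y = real_vec J'" using B(1) by blast
    then show "\<exists>J'\<in>Supp p. J' \<noteq> J \<and> monomial_value p J r \<le> monomial_value p J' r"
      using y \<open>J \<in> Supp p\<close> by (intro bexI[of _ J']) (auto simp: supp monomial_value_eq p_def)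
  qed
  ultimately show "\<exists>p. trop_poly_over K p \<and> Supp p \<noteq> {} \<and> Supp p \<subseteq> S \<and> vanishes_on p R"
    using sub nep by blast
qed

theorem theorem2:
  fixes K :: "real set"
    and S :: "(nat ^ 'n::finite) set"
    and R :: "(real ^ 'n) set"
  assumes "K = UNIV \<or> K = \<rat>"
    and "finite S"
    and "finite R"
    and "R \<subseteq> points_over K"
  shows
    "(card R < card S \<longrightarrow>
        (\<exists>p. trop_poly_over K p \<and> Supp p \<noteq> {} \<and> Supp p \<subseteq> S \<and> vanishes_on p R)) \<and>
     (card R = card S \<longrightarrow>
        ((\<exists>p. trop_poly_over K p \<and> Supp p \<noteq> {} \<and> Supp p \<subseteq> S \<and> vanishes_on p R) \<longleftrightarrow>
         singular (real_vec ` S) R)) \<and>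
     (card R > card S \<longrightarrow>
        ((\<exists>p. trop_poly_over K p \<and> Supp p \<noteq> {} \<and> Supp p \<subseteq> S \<and> vanishes_on p R) \<longleftrightarrow>
         (\<forall>R'. R' \<subseteq> R \<and> card R' = card S \<longrightarrow> singular R' (real_vec ` S))))"
proof -
  let ?S = "real_vec ` S"
  have finS: "finite ?S" using assms(2) by simp
  have card: "card ?S = card S"
    using inj_real_vec by (intro card_image) (auto intro: inj_on_subset)
  have dep_K: "tropically_dependent K (\<bullet>) R ?S" if dep: "tropically_dependent UNIV (\<bullet>) R ?S"
    using assms(1)
  proof
    assume K: "K = \<rat>"
    have "r \<bullet> x \<in> \<rat>" if "r \<in> R" "x \<in> ?S" for r x
      using that assms(4) unfolding K points_over_def inner_vec_def real_vec_def
      by (auto intro!: Rats_sum)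
    then show ?thesis
      using tropically_dependent_rational[OF assms(3) finS _ dep] K by simp
  qed (use dep in simp)
  have main: "tropically_dependent K (\<bullet>) R ?S \<longleftrightarrow>
      (\<forall>R'. R' \<subseteq> R \<and> card R' = card S \<longrightarrow> singular R' ?S)" (is "_ \<longleftrightarrow> ?sing")
  proof
    assume "tropically_dependent K (\<bullet>) R ?S"
    then show ?sing
      using tropically_dependent_imp_not_uniquely_assignable[OF finS]
      unfolding singular_def nonsingular_iff_uniquely_assignable by blast
  next
    assume sing: ?sing
    show "tropically_dependent K (\<bullet>) R ?S"
    proof (rule ccontr)
      assume "\<not> ?thesis"
      then obtain c where
        "\<forall>x\<in>?S. \<exists>r\<in>R. \<forall>y\<in>?S. y \<noteq> x \<longrightarrow> c y + r \<bullet> y < c x + r \<bullet> x"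
        using dependent_or_every_column_dominates[OF assms(3) finS, of "(\<bullet>)"] dep_K by blast
      from column_domination_imp_uniquely_assignable[OF finS this]
      obtain R' where "R' \<subseteq> R" "card R' = card S" "uniquely_assignable (\<bullet>) R' ?S"
        unfolding card by (elim exE conjE)
      then show False
        using sing unfolding singular_def nonsingular_iff_uniquely_assignable by blast
    qed
  qed
  have "card R < card S \<longrightarrow> ?sing"
    by (auto dest!: card_mono[OF assms(3)])
  moreover have "?sing \<longleftrightarrow> singular R ?S" if "card R = card S"
    using that card_subset_eq[OF assms(3)] by (metis order_refl)
  ultimately show ?thesis
    unfolding vanishing_polynomial_iff_tropically_dependent[OF assms(2)] main
    using nonsingular_commute[of R ?S] by (simp add: singular_def)
qed

end
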